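(* Let $k\ge 1$ and $n\ge 1$ be integers. Then $$G_I(n;k,kt)=\det T_n(f_I),\qquad G_D(n;k,kt)=\det T_n(f_D),$$ where $$f_I(z)=f_I(z;t)=e^{t/z}\,(1+z)^k,\qquad f_D(z)=f_D(z;t)=e^{t/z}\,(1-z)^{-k}.$$
   Context: A word of length $N$ from an alphabet of $k$ letters is a function $w:\{1,\dots,N\}\to\{1,\dots,k\}$; each of the $k^N$ words of length $N$ is given probability $k^{-N}$, and $\mathrm{Prob}_k$ denotes this uniform probability. $\ell_N^I(w)$ is the length of the longest weakly increasing subsequence of $w$, i.e. the largest $m$ for which there are indices $i_1<\dots<i_m$ with $w(i_1)\le\dots\le w(i_m)$. $\ell_N^D(w)$ is the length of the longest strictly decreasing subsequence of $w$, i.e. the largest $m$ for which there are indices $i_1<\dots<i_m$ with $w(i_1)>\dots>w(i_m)$. For $N=0$ there is one (empty) word, with both lengths equal to $0$. Set $$F_I(n;k,N)=\mathrm{Prob}_k(\ell_N^I(w)\le n),\qquad F_D(n;k,N)=\mathrm{Prob}_k(\ell_N^D(w)\le n),$$ $$G_I(n;k,t)=\sum_{N=0}^\infty F_I(n;k,N)\frac{t^N}{N!},\qquad G_D(n;k,t)=\sum_{N=0}^\infty F_D(n;k,N)\frac{t^N}{N!}.$$ For a function (symbol) $f$ with Laurent/Fourier expansion $f(z)=\sum_{i\in\mathbb Z}f_i z^i$, $T_n(f)$ denotes the $n\times n$ Toeplitz matrix whose $(i,j)$ entry is $f_{i-j}$. For $f_D$ the expansion is the Laurent expansion in $0<|z|<1$,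 i.e. the product of $\sum_{r\ge0}\frac{t^r}{r!}z^{-r}$ and the power series of $(1-z)^{-k}$ in nonnegative powers of $z$. *)

theory Defs
  imports
    "HOL-Probability.Probability_Mass_Function"
    "Jordan_Normal_Form.Determinant"
begin

definition words :: "nat \<Rightarrow> nat \<Rightarrow> (nat \<Rightarrow> nat) set" where
  "words k N = {1..N} \<rightarrow>\<^sub>E {1..k}"

definition word_prob :: "nat \<Rightarrow> nat \<Rightarrow> (nat \<Rightarrow> nat) set \<Rightarrow> real" where
  "word_prob k N A = measure_pmf.prob (pmf_of_set (words k N)) A"

text \<open>In the next two definitions, \<open>i 1 < \<dots> < i m\<close> are the positions of a subsequence of \<open>w\<close>.
  The set always contains 0 and is bounded by \<open>N\<close>, so \<open>Max\<close> is a genuine maximum.\<close>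

definition ell_I :: "nat \<Rightarrow> (nat \<Rightarrow> nat) \<Rightarrow> nat" where
  "ell_I N w = Max {m. \<exists>i. i \<in> {1..m} \<rightarrow> {1..N} \<and> strict_mono_on {1..m} i \<and>
                          mono_on {1..m} (w \<circ> i)}"

definition ell_D :: "nat \<Rightarrow> (nat \<Rightarrow> nat) \<Rightarrow> nat" where
  "ell_D N w = Max {m. \<exists>i. i \<in> {1..m} \<rightarrow> {1..N} \<and> strict_mono_on {1..m} i \<and>
                          strict_antimono_on {1..m} (w \<circ> i)}"

definition F_I :: "nat \<Rightarrow> nat \<Rightarrow> nat \<Rightarrow> real" where
  "F_I n k N = word_prob k N {w. ell_I N w \<le> n}"

definition F_D :: "nat \<Rightarrow> nat \<Rightarrow> nat \<Rightarrow> real" where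
  "F_D n k N = word_prob k N {w. ell_D N w \<le> n}"

definition G_I :: "nat \<Rightarrow> nat \<Rightarrow> complex \<Rightarrow> complex" where
  "G_I n k t = (\<Sum>N. of_real (F_I n k N) * t ^ N / fact N)"

definition G_D :: "nat \<Rightarrow> nat \<Rightarrow> complex \<Rightarrow> complex" where
  "G_D n k t = (\<Sum>N. of_real (F_D n k N) * t ^ N / fact N)"

lemma summable_prob_exp:
  fixes t :: complex
  assumes "\<And>N. p N = word_prob k N (A N)"
  shows "summable (\<lambda>N. of_real (p N) * t ^ N / fact N)"
proof (rule summable_comparison_test')
  show "summable (\<lambda>N. inverse (fact N) * norm t ^ N)"
    by (rule summable_exp)
  show "norm (of_real (p N) * t ^ N / fact N) \<le> inverse (fact N) * norm t ^ N" for N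
  proof -
    have "0 \<le> p N" "p N \<le> 1"
      by (simp_all add: assms word_prob_def)
    hence "\<bar>p N\<bar> * norm t ^ N \<le> 1 * norm t ^ N"
      by (intro mult_right_mono) auto
    thus ?thesis
      by (simp add: norm_mult norm_divide norm_power divide_simps)
  qed
qed

lemmas summable_G_I = summable_prob_exp[where p = "F_I n k" for n k, OF F_I_def]
lemmas summable_G_D = summable_prob_exp[where p = "F_D n k" for n k, OF F_D_def]

text \<open>The domain \<open>A\<close> is part of the data, since a function may have different Laurent expansions
  in different annuli. Summation over all integers is unconditional (hence absolute), as it is
  for a Laurent series inside its annulus of convergence.\<close>

definition is_laurent_expansion :: "complex set \<Rightarrow> (complex \<Rightarrow> complex) \<Rightarrow> (int \<Rightarrow> complex) \<Rightarrow> bool" where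
  "is_laurent_expansion A f a \<longleftrightarrow> (\<forall>z\<in>A. ((\<lambda>i. a i * z powi i) has_sum f z) UNIV)"

definition laurent_coeff :: "complex set \<Rightarrow> (complex \<Rightarrow> complex) \<Rightarrow> int \<Rightarrow> complex" where
  "laurent_coeff A f = (THE a. is_laurent_expansion A f a)"

definition toeplitz :: "nat \<Rightarrow> complex set \<Rightarrow> (complex \<Rightarrow> complex) \<Rightarrow> complex mat" where
  "toeplitz n A f = mat n n (\<lambda>(i, j). laurent_coeff A f (int i - int j))"

definition f_I :: "nat \<Rightarrow> complex \<Rightarrow> complex \<Rightarrow> complex" where
  "f_I k t z = exp (t / z) * (1 + z) ^ k"

definition f_D :: "nat \<Rightarrow> complex \<Rightarrow> complex \<Rightarrow> complex" where
  "f_D k t z = exp (t / z) * (1 - z) powi (- int k)"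

end

theory Submission
  imports Defs "HOL-Complex_Analysis.Complex_Analysis" "HOL-Library.Sublist"
begin

text \<open>
  Reading a word from left to right as in patience sorting, one remembers for each \<open>j \<le> n\<close> the
  smallest letter at which a chain of length \<open>j\<close> can end (a chain is a weakly, respectively
  strictly, increasing subsequence). This memory is a vector \<open>0 = b 0 \<le> b 1 \<le> \<dots> \<le> b n \<le> k\<close>, where
  \<open>b j\<close> is the number of letters that extend no such chain. A letter \<open>x\<close> with
  \<open>b j < x \<le> b (j + 1)\<close> sets \<open>b (j + 1)\<close> to \<open>x - 1\<close> (weak case) or \<open>x\<close> (strict case), and a
  letter \<open>x > b n\<close> completes a chain of length \<open>n + 1\<close>. So the words of length \<open>N\<close> without such a
  chain are the \<open>N\<close>-step paths, with steps labelled by letters, that start in \<open>(0, k, \<dots>, k)\<close>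
  (\<open>admissible_Cons_iff\<close>, \<open>card_admissible_words_Suc\<close>).

  The exponential generating functions \<open>u b t\<close> of the numbers of paths starting in \<open>b\<close> are
  characterised by \<open>u b 0 = 1\<close> and a linear system: the derivative of \<open>u b\<close> is the sum of
  \<open>u b'\<close> over the successors \<open>b'\<close> of \<open>b\<close>, one for each letter \<open>x \<le> b n\<close>.
  This system is solved by a determinant. Let
  \<open>\<phi> b m\<close> be the coefficient of \<open>z ^ m\<close> in \<open>exp (t / z) (1 + z) ^ b\<close>, respectively
  \<open>exp (t / z) (1 - z) ^ (- b)\<close>, and put \<open>D b = det (\<phi> (b (j + 1)) (i - j))\<close>, so that each
  threshold governs one column. Differentiation in \<open>t\<close> raises \<open>m\<close> by one, so the derivative of \<open>D b\<close>
  is the sum over \<open>j\<close> of the determinants in which column \<open>j\<close> is replaced by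
  \<open>\<phi> (b (j + 1)) (i - j + 1)\<close>. The recursion of the binomial coefficients telescopes to
  \<open>\<phi> (b (j + 1)) (m + 1) - \<phi> (b j) (m + 1)\<close> being the sum of \<open>\<phi> x' m\<close> over the values \<open>x'\<close> to which
  \<open>b (j + 1)\<close> can be set, which gives exactly the determinants of the successors. The boundary
  term \<open>\<phi> (b j) (i - j + 1)\<close> contributes nothing: for \<open>j > 0\<close> it repeats column \<open>j - 1\<close>, and for
  \<open>j = 0\<close> it is the coefficient of a positive power of \<open>z\<close> in \<open>exp (t / z)\<close>, hence zero
  (\<open>threshold_det_deriv\<close>).
  At the starting vector all columns carry the threshold \<open>k\<close>, and \<open>D b\<close> is the Toeplitz determinant.

  It remains to match the two sides with their definitions. Reversing a word turns strictly
  decreasing subsequences into strictly increasing ones, and Liouville's theorem shows that the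
  Laurent coefficients are unique, so that they are the numbers \<open>\<phi> k m\<close>.
\<close>

section \<open>Chain-free words as paths of threshold vectors\<close>

text \<open>For letters \<open>x \<ge> 1\<close> this is \<open>x \<le> y\<close> or \<open>x < y\<close>; the present form is the one in which the
  threshold \<open>x - of_bool weak\<close> left behind by \<open>x\<close> appears.\<close>

definition prec :: "bool \<Rightarrow> nat \<Rightarrow> nat \<Rightarrow> bool" where
  "prec weak x y \<longleftrightarrow> x - of_bool weak < y"

text \<open>The word \<open>xs\<close> is a continuation of a prefix with thresholds \<open>b\<close>. A chain of \<open>xs\<close> can be
  attached to some chain of length \<open>j\<close> in the prefix if and only if its first letter exceeds
  \<open>b j\<close>; the condition says that no chain of total length \<open>n + 1\<close> arises in this way. The empty chain,
  \<open>j = 0\<close>, is included.\<close>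

definition admissible :: "bool \<Rightarrow> nat \<Rightarrow> (nat \<Rightarrow> nat) \<Rightarrow> nat list \<Rightarrow> bool" where
  "admissible weak n b xs \<longleftrightarrow>
     (\<forall>j\<le>n. \<forall>c. subseq c xs \<longrightarrow> sorted_wrt (prec weak) c \<longrightarrow> length c = n + 1 - j \<longrightarrow> hd c \<le> b j)"

definition threshold_vector :: "nat \<Rightarrow> nat \<Rightarrow> (nat \<Rightarrow> nat) \<Rightarrow> bool" where
  "threshold_vector k n b \<longleftrightarrow> b 0 = 0 \<and> (\<forall>j<n. b j \<le> b (Suc j)) \<and> b n \<le> k"

lemma threshold_vector_mono:
  assumes "threshold_vector k n b" "i \<le> j" "j \<le> n"
  shows "b i \<le> b j"
  using assms(2,3)
proof (induction j rule: dec_induct)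
  case (step m)
  then show ?case
    using assms(1) unfolding threshold_vector_def by (meson Suc_le_eq le_trans less_imp_le)
qed simp

lemma threshold_vector_update:
  assumes "threshold_vector k n b" "j < n" "b j < x" "x \<le> b (Suc j)"
  shows "threshold_vector k n (b(Suc j := x - of_bool weak))"
proof -
  have "b i \<le> b (Suc i)" if "i < n" for i
    using assms(1) that by (simp add: threshold_vector_def)
  moreover have "b (Suc j) \<le> b (Suc (Suc j))" if "Suc j < n"
    using assms(1) that by (simp add: threshold_vector_def)
  moreover have "b (Suc j) \<le> k"
    using threshold_vector_mono[OF assms(1), of "Suc j" n] assms(1,2)
    by (auto simp: threshold_vector_def)
  moreover have "x - of_bool weak \<le> b (Suc j)" "b j \<le> x - of_bool weak"
    using assms(3,4) by (auto simp: of_bool_def)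
  ultimately show ?thesis
    using assms unfolding threshold_vector_def by fastforce
qed

lemma admissible_Cons_le:
  assumes "admissible weak n b (x # xs)"
  shows "x \<le> b n"
proof -
  have "hd [x] \<le> b n"
    using assms unfolding admissible_def by (rule allE[of _ n]) (auto dest: spec[of _ "[x]"])
  then show ?thesis by simp
qed

text \<open>A letter \<open>x\<close> between \<open>b j\<close> and \<open>b (Suc j)\<close> extends a chain of length \<open>j\<close>, but no longer one,
  and it becomes the best possible end of a chain of length \<open>j + 1\<close>. So a chain beginning with \<open>x\<close>
  at a level \<open>i \<le> j\<close> can be traded for the tail of that chain at level \<open>j + 1\<close>, and conversely.\<close>

lemma admissible_Cons_iff:
  assumes b: "threshold_vector k n b" and j: "j < n" "b j < x" "x \<le> b (Suc j)"
  shows "admissible weak n b (x # xs) \<longleftrightarrow> admissible weak n (b(Suc j := x - of_bool weak)) xs"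
proof
  assume adm: "admissible weak n b (x # xs)"
  show "admissible weak n (b(Suc j := x - of_bool weak)) xs"
    unfolding admissible_def
  proof (intro allI impI)
    fix i c assume i: "i \<le> n" and c: "subseq c xs" "sorted_wrt (prec weak) c" "length c = n + 1 - i"
    show "hd c \<le> (b(Suc j := x - of_bool weak)) i"
    proof (cases "i = Suc j")
      case False
      have "hd c \<le> b i"
        using adm i c unfolding admissible_def by blast
      then show ?thesis using False by simp
    next
      case True
      have "hd c \<le> x - of_bool weak"
      proof (rule ccontr)
        assume above: "\<not> hd c \<le> x - of_bool weak"
        from c(3) i obtain y ys where y: "c = y # ys" by (cases c) auto
        have "sorted_wrt (prec weak) (x # c)"
          using above c(2) j(2) unfolding y by (auto simp: prec_def of_bool_def split: if_splits)
        moreover have "length (x # c) = n + 1 - j" "j \<le> n"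
          using c(3) True j(1) by auto
        moreover have "subseq (x # c) (x # xs)"
          using c(1) by simp
        ultimately have "hd (x # c) \<le> b j"
          using adm unfolding admissible_def by blast
        then show False using j(2) by simp
      qed
      then show ?thesis using True by simp
    qed
  qed
next
  assume adm: "admissible weak n (b(Suc j := x - of_bool weak)) xs"
  show "admissible weak n b (x # xs)"
    unfolding admissible_def
  proof (intro allI impI)
    fix i c assume i: "i \<le> n" and c: "subseq c (x # xs)" "sorted_wrt (prec weak) c" "length c = n + 1 - i"
    from c(3) i obtain y ys where y: "c = y # ys" by (cases c) auto
    show "hd c \<le> b i"
    proof (cases "subseq c xs")
      case True
      then have "hd c \<le> (b(Suc j := x - of_bool weak)) i"
        using adm i c unfolding admissible_def by blast
      also have "\<dots> \<le> b i" using j by auto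
      finally show ?thesis .
    next
      case False
      then have x: "y = x" and ys: "subseq ys xs"
        using c(1) unfolding y by (auto split: if_splits)
      show ?thesis
      proof (rule ccontr)
        assume above: "\<not> hd c \<le> b i"
        then have "\<not> Suc j \<le> i"
          using threshold_vector_mono[OF b, of "Suc j" i] i j(3) x y by auto
        then have ij: "i \<le> j" by simp
        \<comment> \<open>discarding the first \<open>j - i\<close> elements after \<open>x\<close> leaves a chain of the length
          controlled by the updated threshold\<close>
        define d where "d = drop (j - i) ys"
        have d: "length d = n + 1 - Suc j"
          using c(3) ij j(1) unfolding d_def y by simp
        then have "d \<noteq> []" using j(1) by auto
        moreover have "set d \<subseteq> set ys"
          unfolding d_def by (rule set_drop_subset)
        ultimately have "hd d \<in> set ys" by auto
        then have "x - of_bool weak < hd d"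
          using c(2) unfolding y x by (simp add: prec_def)
        moreover have "subseq d xs"
          using ys suffix_drop[of "j - i" ys] unfolding d_def
          by (meson suffix_imp_subseq subseq_order.trans)
        moreover have "sorted_wrt (prec weak) d"
          using c(2) unfolding y d_def by (simp add: sorted_wrt_drop)
        ultimately show False
          using adm d j(1) unfolding admissible_def by (metis Suc_leI fun_upd_same not_le)
      qed
    qed
  qed
qed

definition admissible_words :: "bool \<Rightarrow> nat \<Rightarrow> nat \<Rightarrow> nat \<Rightarrow> (nat \<Rightarrow> nat) \<Rightarrow> nat list set" where
  "admissible_words weak k n N b =
     {xs. set xs \<subseteq> {1..k} \<and> length xs = N \<and> admissible weak n b xs}"

lemma finite_admissible_words: "finite (admissible_words weak k n N b)"
  by (rule finite_subset[OF _ finite_lists_length_eq[of "{1..k}" N]])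
     (auto simp: admissible_words_def)

text \<open>The intervals between consecutive thresholds sort the letters by the column that they change.\<close>

lemma sum_split_at_thresholds:
  fixes f :: "nat \<Rightarrow> 'a :: comm_monoid_add"
  assumes "\<And>j. j < n \<Longrightarrow> b j \<le> b (Suc j)"
  shows "(\<Sum>x\<in>{b 0<..b n}. f x) = (\<Sum>j<n. \<Sum>x\<in>{b j<..b (Suc j)}. f x)"
  using assms
proof (induction n)
  case (Suc n)
  note 1 = Suc.prems
  have "b 0 \<le> b m" if "m \<le> n" for m
    using that
  proof (induction m)
    case (Suc m)
    then show ?case using 1[of m] by simp
  qed simp
  from this[of n] have "{b 0<..b (Suc n)} = {b 0<..b n} \<union> {b n<..b (Suc n)}"
    using Suc.prems[of n] by auto
  then show ?case
    using Suc by (simp add: sum.union_disjoint)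
qed simp

lemma card_admissible_words_Suc:
  assumes b: "threshold_vector k n b"
  shows "card (admissible_words weak k n (Suc N) b) =
    (\<Sum>j<n. \<Sum>x\<in>{b j<..b (Suc j)}. card (admissible_words weak k n N (b(Suc j := x - of_bool weak))))"
proof -
  define T where "T x = {xs. x # xs \<in> admissible_words weak k n (Suc N) b}" for x
  have b0: "b 0 = 0" "b n \<le> k" using b by (auto simp: threshold_vector_def)
  have eq: "admissible_words weak k n (Suc N) b = (\<Union>x\<in>{b 0<..b n}. (#) x ` T x)"
  proof (intro equalityI subsetI)
    fix xs assume xs: "xs \<in> admissible_words weak k n (Suc N) b"
    then obtain x ys where "xs = x # ys"
      by (cases xs) (auto simp: admissible_words_def)
    moreover from this xs b0 have "x \<in> {b 0<..b n}"
      by (auto simp: admissible_words_def dest: admissible_Cons_le)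
    ultimately show "xs \<in> (\<Union>x\<in>{b 0<..b n}. (#) x ` T x)"
      using xs by (auto simp: T_def)
  qed (auto simp: T_def)
  have fin: "finite (T x)" for x
    using finite_vimageI[OF finite_admissible_words[of weak k n "Suc N" b], of "(#) x"]
    by (simp add: T_def vimage_def inj_on_def)
  have "card (admissible_words weak k n (Suc N) b) = (\<Sum>x\<in>{b 0<..b n}. card ((#) x ` T x))"
    unfolding eq using fin by (intro card_UN_disjoint) auto
  also have "\<dots> = (\<Sum>x\<in>{b 0<..b n}. card (T x))"
    by (intro sum.cong refl card_image) (auto simp: inj_on_def)
  also have "\<dots> = (\<Sum>j<n. \<Sum>x\<in>{b j<..b (Suc j)}. card (T x))"
    using b by (intro sum_split_at_thresholds) (auto simp: threshold_vector_def)
  also have "\<dots> = (\<Sum>j<n. \<Sum>x\<in>{b j<..b (Suc j)}.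
      card (admissible_words weak k n N (b(Suc j := x - of_bool weak))))"
  proof (intro sum.cong refl arg_cong[where f = card])
    fix j x assume j: "j \<in> {..<n}" and x: "x \<in> {b j<..b (Suc j)}"
    have "b (Suc j) \<le> k"
      using threshold_vector_mono[OF b, of "Suc j" n] b0 j by auto
    then show "T x = admissible_words weak k n N (b(Suc j := x - of_bool weak))"
      using admissible_Cons_iff[OF b, of j x weak] j x
      by (auto simp: T_def admissible_words_def)
  qed
  finally show ?thesis .
qed

lemma card_admissible_words_0: "card (admissible_words weak k n 0 b) = 1"
proof -
  have "admissible_words weak k n 0 b = {[]}"
    by (auto simp: admissible_words_def admissible_def)
  then show ?thesis by simp
qed

abbreviation initial_thresholds :: "nat \<Rightarrow> nat \<Rightarrow> nat" where
  "initial_thresholds k \<equiv> \<lambda>j. if j = 0 then 0 else k"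

section \<open>Word probabilities as path counts\<close>

text \<open>Subsequences given by increasing positions are replaced by the inductive relation on lists,
  which suits reading a word letter by letter.\<close>

lemma index_chain_iff_subseq:
  "(\<exists>i. i \<in> {1..m} \<rightarrow> {1..N} \<and> strict_mono_on {1..m} i \<and> monotone_on {1..m} (<) R (w \<circ> i))
   \<longleftrightarrow> (\<exists>c. subseq c (map w [1..<Suc N]) \<and> length c = m \<and> sorted_wrt R c)"
  (is "?lhs \<longleftrightarrow> ?rhs")
proof
  assume ?lhs
  then obtain i where i: "i \<in> {1..m} \<rightarrow> {1..N}" "strict_mono_on {1..m} i"
    "monotone_on {1..m} (<) R (w \<circ> i)" by blast
  let ?c = "map i [1..<Suc m]"
  have "subseq ?c [1..<Suc N]"
  proof (rule sorted_subset_imp_subseq)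
    show "set ?c \<subseteq> set [1..<Suc N]"
      using i(1) by (auto simp: Pi_iff less_Suc_eq_le simp del: upt_Suc)
    show "sorted_wrt (<) ?c"
      using i(2) by (auto simp: sorted_wrt_iff_nth_less strict_mono_on_def simp del: upt_Suc)
  qed (simp del: upt_Suc)
  then have "subseq (map w ?c) (map w [1..<Suc N])" by (rule subseq_map)
  moreover have "sorted_wrt R (map w ?c)"
    using i(3) by (auto simp: sorted_wrt_iff_nth_less monotone_on_def simp del: upt_Suc)
  moreover have "length (map w ?c) = m" by simp
  ultimately show ?rhs by blast
next
  assume ?rhs
  then obtain c where c: "subseq c (map w [1..<Suc N])" "length c = m" "sorted_wrt R c" by blast
  then obtain I where I: "c = map w (nths [1..<Suc N] I)"
    unfolding subseq_conv_nths by (auto simp: nths_map)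
  define d where "d = nths [1..<Suc N] I"
  have d: "length d = m" "c = map w d" using c(2) I by (auto simp: d_def)
  have "sorted_wrt (<) d"
    unfolding d_def strict_sorted_iff by (intro conjI sorted_nths distinct_nthsI) (simp_all del: upt_Suc)
  then have less: "d ! x < d ! y" if "x < y" "y < m" for x y
    using that d by (simp add: sorted_wrt_iff_nth_less)
  have "set d \<subseteq> {1..N}"
    using set_nths_subset[of "[1..<Suc N]" I] by (auto simp: d_def)
  then have "(\<lambda>j. d ! (j - 1)) \<in> {1..m} \<rightarrow> {1..N}"
    using d(1) by (auto simp: subset_iff)
  moreover have "strict_mono_on {1..m} (\<lambda>j. d ! (j - 1))"
    by (auto simp: strict_mono_on_def intro!: less)
  moreover have "monotone_on {1..m} (<) R (w \<circ> (\<lambda>j. d ! (j - 1)))"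
    using c(3) d unfolding monotone_on_def sorted_wrt_iff_nth_less by auto
  ultimately show ?lhs by blast
qed

text \<open>Initial segments of chains are chains, so the possible lengths have no gaps and only the
  length \<open>Suc n\<close> has to be excluded.\<close>

lemma Max_chain_length_le_iff:
  "Max {m. \<exists>c. subseq c xs \<and> length c = m \<and> sorted_wrt R c} \<le> n \<longleftrightarrow>
   \<not> (\<exists>c. subseq c xs \<and> length c = Suc n \<and> sorted_wrt R c)"
  (is "Max ?S \<le> n \<longleftrightarrow> _")
proof -
  have "?S \<subseteq> {..length xs}" by (auto dest: list_emb_length)
  then have "finite ?S" by (rule finite_subset) simp
  moreover have "0 \<in> ?S" by auto
  ultimately have "Max ?S \<le> n \<longleftrightarrow> (\<forall>m\<in>?S. m \<le> n)"
    by (intro Max_le_iff) blast+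
  also have "\<dots> \<longleftrightarrow> Suc n \<notin> ?S"
  proof
    assume none: "Suc n \<notin> ?S"
    show "\<forall>m\<in>?S. m \<le> n"
    proof (rule ccontr)
      assume "\<not> (\<forall>m\<in>?S. m \<le> n)"
      then obtain c where c: "subseq c xs" "sorted_wrt R c" "n < length c" by auto
      have "subseq (take (Suc n) c) xs"
        using c(1) by (meson prefix_imp_subseq subseq_order.trans take_is_prefix)
      moreover have "sorted_wrt R (take (Suc n) c)" "length (take (Suc n) c) = Suc n"
        using c by (auto simp: sorted_wrt_take)
      ultimately show False using none by blast
    qed
  qed auto
  finally show ?thesis by simp
qed

text \<open>On a linear order monotonicity only concerns distinct arguments; in this form weakly and
  strictly monotone subsequences are covered by the same lemma.\<close>

lemma mono_on_iff_monotone_less: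
  fixes f :: "nat \<Rightarrow> nat"
  shows "mono_on A f \<longleftrightarrow> monotone_on A (<) (\<le>) f"
  by (auto simp: monotone_on_def le_less)

lemma ell_I_le_iff:
  "ell_I N w \<le> n \<longleftrightarrow>
   \<not> (\<exists>c. subseq c (map w [1..<Suc N]) \<and> length c = Suc n \<and> sorted_wrt (\<le>) c)"
  unfolding ell_I_def mono_on_iff_monotone_less index_chain_iff_subseq Max_chain_length_le_iff ..

lemma ell_D_le_iff:
  "ell_D N w \<le> n \<longleftrightarrow>
   \<not> (\<exists>c. subseq c (map w [1..<Suc N]) \<and> length c = Suc n \<and> sorted_wrt (>) c)"
  unfolding ell_D_def index_chain_iff_subseq Max_chain_length_le_iff ..

lemma bij_betw_words_lists:
  "bij_betw (\<lambda>w. map w [1..<Suc N]) (words k N) {xs. set xs \<subseteq> {1..k} \<and> length xs = N}"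
proof (rule bij_betwI[where g = "\<lambda>xs. \<lambda>i\<in>{1..N}. xs ! (i - 1)"])
  show "(\<lambda>w. map w [1..<Suc N]) \<in> words k N \<rightarrow> {xs. set xs \<subseteq> {1..k} \<and> length xs = N}"
    unfolding words_def by fastforce
  show "(\<lambda>xs. \<lambda>i\<in>{1..N}. xs ! (i - 1)) \<in> {xs. set xs \<subseteq> {1..k} \<and> length xs = N} \<rightarrow> words k N"
    unfolding words_def by (fastforce dest: subsetD[OF _ nth_mem])
  show "(\<lambda>i\<in>{1..N}. map w [1..<Suc N] ! (i - 1)) = w" if "w \<in> words k N" for w
    using that unfolding words_def
    by (auto simp: fun_eq_iff PiE_def extensional_def restrict_def simp del: upt_Suc)
  show "map (\<lambda>i\<in>{1..N}. xs ! (i - 1)) [1..<Suc N] = xs"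
    if "xs \<in> {xs. set xs \<subseteq> {1..k} \<and> length xs = N}" for xs
    using that by (intro nth_equalityI) (auto simp del: upt_Suc)
qed

lemma word_prob_eq_card_lists:
  assumes "k \<ge> 1"
  shows "word_prob k N {w. P (map w [1..<Suc N])} =
    card {xs. set xs \<subseteq> {1..k} \<and> length xs = N \<and> P xs} / real k ^ N"
proof -
  have bij: "bij_betw F (W \<inter> {w. P (F w)}) {x \<in> T. P x}" if "bij_betw F W T"
    for F :: "(nat \<Rightarrow> nat) \<Rightarrow> nat list" and W T
    using that by (auto simp: bij_betw_def inj_on_def)
  have "card (words k N \<inter> {w. P (map w [1..<Suc N])}) =
      card {xs. set xs \<subseteq> {1..k} \<and> length xs = N \<and> P xs}"
    using bij[OF bij_betw_words_lists[of N k]]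
    by (auto dest: bij_betw_same_card simp: conj_assoc simp del: upt_Suc)
  moreover have "finite (words k N)" "words k N \<noteq> {}" "card (words k N) = k ^ N"
    using assms by (auto simp: words_def PiE_eq_empty_iff card_PiE intro!: finite_PiE)
  ultimately show ?thesis
    by (simp add: word_prob_def measure_pmf_of_set del: upt_Suc)
qed

lemma sorted_wrt_prec_iff:
  assumes "set c \<subseteq> {1..k}"
  shows "sorted_wrt (prec weak) c \<longleftrightarrow> sorted_wrt (if weak then (\<le>) else (<)) c"
proof -
  have "prec weak x y = (if weak then (\<le>) else (<)) x y" if "x \<in> set c" for x y
  proof -
    have "1 \<le> x" using assms that by auto
    then show ?thesis by (cases weak) (auto simp: prec_def)
  qed
  then show ?thesis
    by (auto intro: sorted_wrt_mono_rel[rotated])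
qed

text \<open>With all thresholds equal to the largest letter \<open>k\<close>, only the level \<open>0\<close> of admissibility is a
  condition, and there every nonempty chain exceeds the threshold \<open>0\<close>.\<close>

lemma admissible_initial_iff:
  assumes xs: "set xs \<subseteq> {1..k}"
  shows "admissible weak n (initial_thresholds k) xs \<longleftrightarrow>
    \<not> (\<exists>c. subseq c xs \<and> length c = Suc n \<and> sorted_wrt (if weak then (\<le>) else (<)) c)"
proof -
  have set_c: "set c \<subseteq> {1..k}" if "subseq c xs" for c
    using xs that set_nths_subset unfolding subseq_conv_nths by fastforce
  have hd_c: "hd c \<in> {1..k}" if "subseq c xs" "length c = Suc m" for c m
    using set_c[OF that(1)] that(2) by (cases c) auto
  show ?thesis
  proof
    assume adm: "admissible weak n (initial_thresholds k) xs"
    show "\<not> (\<exists>c. subseq c xs \<and> length c = Suc n \<and> sorted_wrt (if weak then (\<le>) else (<)) c)"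
    proof
      assume "\<exists>c. subseq c xs \<and> length c = Suc n \<and> sorted_wrt (if weak then (\<le>) else (<)) c"
      then obtain c where c: "subseq c xs" "length c = Suc n" "sorted_wrt (prec weak) c"
        using sorted_wrt_prec_iff[OF set_c] by blast
      then have "hd c \<le> 0"
        using adm unfolding admissible_def by (auto dest: spec[of _ 0])
      then show False using hd_c[OF c(1,2)] by simp
    qed
  next
    assume none: "\<not> (\<exists>c. subseq c xs \<and> length c = Suc n \<and> sorted_wrt (if weak then (\<le>) else (<)) c)"
    show "admissible weak n (initial_thresholds k) xs"
      unfolding admissible_def
    proof (intro allI impI)
      fix j c assume c: "j \<le> n" "subseq c xs" "sorted_wrt (prec weak) c" "length c = n + 1 - j"
      have "j \<noteq> 0"
      proof
        assume "j = 0"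
        then have "length c = Suc n" using c(4) by simp
        then show False using none c(2,3) sorted_wrt_prec_iff[OF set_c[OF c(2)]] by blast
      qed
      moreover have "hd c \<le> k"
        using hd_c[OF c(2), of "n - j"] c(1,4) by simp
      ultimately show "hd c \<le> (if j = 0 then 0 else k)" by simp
    qed
  qed
qed

lemma card_words_without_chain:
  "card {xs. set xs \<subseteq> {1..k} \<and> length xs = N \<and>
      \<not> (\<exists>c. subseq c xs \<and> length c = Suc n \<and> sorted_wrt (if weak then (\<le>) else (<)) c)} =
   card (admissible_words weak k n N (initial_thresholds k))"
  unfolding admissible_words_def
  by (rule arg_cong[where f = card]) (use admissible_initial_iff[of _ k weak n] in blast)

lemma F_I_eq:
  assumes "k \<ge> 1"
  shows "F_I n k N = card (admissible_words True k n N (initial_thresholds k)) / real k ^ N"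
proof -
  have "F_I n k N = word_prob k N {w. \<not> (\<exists>c. subseq c (map w [1..<Suc N]) \<and> length c = Suc n
      \<and> sorted_wrt (\<le>) c)}"
    by (simp only: F_I_def ell_I_le_iff)
  also have "\<dots> = card {xs. set xs \<subseteq> {1..k} \<and> length xs = N
      \<and> \<not> (\<exists>c. subseq c xs \<and> length c = Suc n \<and> sorted_wrt (\<le>) c)} / real k ^ N"
    using assms by (rule word_prob_eq_card_lists)
  also have "\<dots> = card (admissible_words True k n N (initial_thresholds k)) / real k ^ N"
    using card_words_without_chain[of k N n True] by (simp only: if_True)
  finally show ?thesis .
qed

lemma subseq_rev:
  assumes "subseq xs ys"
  shows "subseq (rev xs) (rev ys)"
  using assms by induction (simp_all add: list_emb_append_mono subseq_rev_drop_many)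

lemma subseq_rev_iff: "subseq (rev xs) (rev ys) \<longleftrightarrow> subseq xs ys"
  using subseq_rev[of xs ys] subseq_rev[of "rev xs" "rev ys"] by auto

text \<open>Word reversal exchanges strictly decreasing and strictly increasing subsequences.\<close>

lemma F_D_eq:
  assumes "k \<ge> 1"
  shows "F_D n k N = card (admissible_words False k n N (initial_thresholds k)) / real k ^ N"
proof -
  let ?P = "\<lambda>R xs. \<exists>c. subseq c xs \<and> length c = Suc n \<and> sorted_wrt R c"
  have rev: "?P (<) (rev xs)" if "?P (>) xs" for xs :: "nat list"
    using that by (metis length_rev sorted_wrt_rev subseq_rev_iff)
  moreover have "?P (>) xs" if "?P (<) (rev xs)" for xs :: "nat list"
    using that by (metis length_rev rev_rev_ident sorted_wrt_rev subseq_rev_iff)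
  ultimately have "?P (>) xs \<longleftrightarrow> ?P (<) (rev xs)" for xs :: "nat list" by blast
  then have "bij_betw rev
      {xs. set xs \<subseteq> {1..k} \<and> length xs = N \<and> \<not> ?P (>) xs}
      {xs. set xs \<subseteq> {1..k} \<and> length xs = N \<and> \<not> ?P (<) xs}"
    by (intro bij_betwI[where g = rev]) auto
  then have card_eq: "card {xs. set xs \<subseteq> {1..k} \<and> length xs = N \<and> \<not> ?P (>) xs} =
      card {xs. set xs \<subseteq> {1..k} \<and> length xs = N \<and> \<not> ?P (<) xs}"
    by (rule bij_betw_same_card)
  have "F_D n k N = word_prob k N {w. \<not> ?P (>) (map w [1..<Suc N])}"
    by (simp only: F_D_def ell_D_le_iff)
  also have "\<dots> = card {xs. set xs \<subseteq> {1..k} \<and> length xs = N \<and> \<not> ?P (>) xs} / real k ^ N"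
    using assms by (rule word_prob_eq_card_lists)
  also have "\<dots> = card (admissible_words False k n N (initial_thresholds k)) / real k ^ N"
    using card_words_without_chain[of k N n False] card_eq by (simp only: if_False)
  finally show ?thesis .
qed

section \<open>Determinants as functions of their columns\<close>

text \<open>The matrix is given by its columns, \<open>C j i\<close> being the entry in row \<open>i\<close> of column \<open>j\<close>, so that
  replacing a column is a function update.\<close>

definition column_det :: "nat \<Rightarrow> (nat \<Rightarrow> nat \<Rightarrow> complex) \<Rightarrow> complex" where
  "column_det n C = Determinant.det (mat n n (\<lambda>(i, j). C j i))"

lemma column_det_Leibniz:
  "column_det n C = (\<Sum>p | p permutes {0..<n}. signof p * (\<Prod>j<n. C j (p j)))"
proof -
  have "column_det n C =
      (\<Sum>p | p permutes {0..<n}. signof p * (\<Prod>j<n. mat n n (\<lambda>(i, j). C j i) $$ (p j, j)))"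
    unfolding column_det_def by (rule det_col) simp
  also have "\<dots> = (\<Sum>p | p permutes {0..<n}. signof p * (\<Prod>j<n. C j (p j)))"
  proof (intro sum.cong refl arg_cong2[where f = "(*)"] prod.cong)
    fix p j assume "p \<in> {p. p permutes {0..<n}}" "j \<in> {..<n}"
    then have "p j < n" using permutes_in_image[of p "{0..<n}" j] by auto
    then show "mat n n (\<lambda>(i, j). C j i) $$ (p j, j) = C j (p j)"
      using \<open>j \<in> {..<n}\<close> by simp
  qed
  finally show ?thesis .
qed

lemma column_det_cong:
  assumes "\<And>i j. i < n \<Longrightarrow> j < n \<Longrightarrow> C j i = C' j i"
  shows "column_det n C = column_det n C'"
  unfolding column_det_def using assms by (intro arg_cong[where f = Determinant.det]) auto

lemma column_det_update:
  assumes "j < n"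
  shows "column_det n (C(j := v)) =
    (\<Sum>p | p permutes {0..<n}. signof p * (v (p j) * (\<Prod>l\<in>{..<n} - {j}. C l (p l))))"
proof -
  have "(\<Prod>l<n. (C(j := v)) l (p l)) = v (p j) * (\<Prod>l\<in>{..<n} - {j}. C l (p l))" for p :: "nat \<Rightarrow> nat"
    using assms by (subst prod.remove[of _ j]) (auto intro!: prod.cong)
  then show ?thesis by (simp add: column_det_Leibniz)
qed

lemma column_det_update_diff:
  assumes "j < n"
  shows "column_det n (C(j := \<lambda>i. u i - v i)) = column_det n (C(j := u)) - column_det n (C(j := v))"
  by (simp add: column_det_update[OF assms] sum_subtractf[symmetric] algebra_simps)

lemma column_det_update_sum:
  assumes "j < n"
  shows "column_det n (C(j := \<lambda>i. \<Sum>x\<in>X. u x i)) = (\<Sum>x\<in>X. column_det n (C(j := u x)))"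
  unfolding column_det_update[OF assms]
  by (subst sum.swap) (simp add: sum_distrib_left sum_distrib_right)

lemma column_det_equal_columns:
  assumes "j < n" "l < n" "j \<noteq> l" "\<And>i. i < n \<Longrightarrow> C j i = C l i"
  shows "column_det n C = 0"
proof -
  let ?A = "mat n n (\<lambda>(i, j). C j i)"
  have "Determinant.det (transpose_mat ?A) = 0"
    using assms by (intro det_identical_rows[of _ n j l]) (auto intro!: eq_vecI)
  then show ?thesis
    unfolding column_det_def by (subst (asm) det_transpose[of _ n]) auto
qed

lemma column_det_zero_column:
  assumes "j < n" "\<And>i. i < n \<Longrightarrow> C j i = 0"
  shows "column_det n C = 0"
proof -
  have "column_det n C = column_det n (C(j := \<lambda>i. 0))"
    using assms(2) by (intro column_det_cong) auto
  then show ?thesis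
    by (simp add: column_det_update[OF assms(1)])
qed

lemma has_field_derivative_column_det:
  assumes "\<And>i j. (C j i has_field_derivative C' j i) (at t)"
  shows "((\<lambda>s. column_det n (\<lambda>j i. C j i s)) has_field_derivative
           (\<Sum>j<n. column_det n ((\<lambda>j i. C j i t)(j := C' j)))) (at t)"
proof -
  have "((\<lambda>s. \<Sum>p | p permutes {0..<n}. signof p * (\<Prod>j<n. C j (p j) s)) has_field_derivative
      (\<Sum>p | p permutes {0..<n}.
         signof p * (\<Sum>j<n. C' j (p j) * (\<Prod>l\<in>{..<n} - {j}. C l (p l) t)))) (at t)"
    using assms by (intro DERIV_sum DERIV_cmult has_field_derivative_prod)
  also have "(\<Sum>p | p permutes {0..<n}.
         signof p * (\<Sum>j<n. C' j (p j) * (\<Prod>l\<in>{..<n} - {j}. C l (p l) t))) =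
      (\<Sum>j<n. column_det n ((\<lambda>j i. C j i t)(j := C' j)))"
    by (simp add: column_det_update sum_distrib_left sum.swap[of _ _ "{..<n}"])
  finally show ?thesis by (simp add: column_det_Leibniz)
qed

section \<open>The determinantal solution of the path counting problem\<close>

text \<open>The coefficient of \<open>z ^ m\<close> in \<open>(1 + z) ^ b\<close> (weak case) or \<open>(1 - z) ^ (- b)\<close> (strict case).\<close>

definition gen_coeff :: "bool \<Rightarrow> nat \<Rightarrow> int \<Rightarrow> nat" where
  "gen_coeff weak b m =
     (if m < 0 then 0 else if weak then b choose nat m else (b + nat m - 1) choose nat m)"

text \<open>This is \<open>(1 + z) ^ x = (1 + z) ^ (x - 1) + z (1 + z) ^ (x - 1)\<close>, respectively
  \<open>(1 - z) ^ (- x) = (1 - z) ^ (- (x - 1)) + z (1 - z) ^ (- x)\<close>. The exponent of the last power is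
  \<open>x - of_bool weak\<close>, which is also the threshold left behind by the letter \<open>x\<close>: this coincidence is
  what makes both cases of the theorem instances of one argument.\<close>

lemma gen_coeff_step:
  assumes "0 < x"
  shows "gen_coeff weak x (m + 1) =
         gen_coeff weak (x - 1) (m + 1) + gen_coeff weak (x - of_bool weak) m"
proof -
  obtain y where y: "x = Suc y" using assms by (cases x) auto
  show ?thesis
  proof (cases "m \<ge> 0")
    case True
    then obtain i where "m = int i" by (rule nonneg_int_cases)
    moreover from this have "nat (m + 1) = Suc i" by simp
    ultimately show ?thesis by (cases weak) (simp_all add: gen_coeff_def y)
  next
    case False
    then have "m + 1 < 0 \<or> m + 1 = 0" by linarith
    then show ?thesis by (auto simp: gen_coeff_def)
  qed
qed

lemma gen_coeff_0: "m > 0 \<Longrightarrow> gen_coeff weak 0 m = 0"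
  by (simp add: gen_coeff_def)

lemma gen_coeff_constant: "gen_coeff weak b 0 = 1"
  by (simp add: gen_coeff_def)

lemma gen_coeff_le: "gen_coeff weak b (m + int N) \<le> 2 ^ (b + nat m) * 2 ^ N"
proof (cases "m + int N < 0")
  case False
  let ?i = "nat (m + int N)"
  have "b choose ?i \<le> 2 ^ (b + ?i)" "(b + ?i - 1) choose ?i \<le> 2 ^ (b + ?i)"
    by (rule order.trans[OF binomial_le_pow2 power_increasing]; simp)+
  then have "gen_coeff weak b (m + int N) \<le> 2 ^ (b + ?i)"
    using False by (simp add: gen_coeff_def)
  also have "\<dots> \<le> 2 ^ (b + nat m + N)"
    by (intro power_increasing) auto
  finally show ?thesis by (simp add: power_add)
qed (simp add: gen_coeff_def)

text \<open>The Laurent coefficients of \<open>exp (t / z)\<close> times the generating function of \<open>gen_coeff\<close>,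
  the first factor contributing \<open>t ^ N / fact N * z ^ (- N)\<close>.\<close>

definition symbol_coeff :: "bool \<Rightarrow> nat \<Rightarrow> int \<Rightarrow> complex \<Rightarrow> complex" where
  "symbol_coeff weak b m t = (\<Sum>N. of_nat (gen_coeff weak b (m + int N)) / fact N * t ^ N)"

lemma summable_norm_symbol_coeff:
  "summable (\<lambda>N. norm (of_nat (gen_coeff weak b (m + int N)) / fact N * t ^ N :: complex))"
proof (rule summable_comparison_test')
  show "summable (\<lambda>N. 2 ^ (b + nat m) * (inverse (fact N) * (2 * norm t) ^ N))"
    by (intro summable_mult summable_exp)
  show "norm (norm (of_nat (gen_coeff weak b (m + int N)) / fact N * t ^ N :: complex))
      \<le> 2 ^ (b + nat m) * (inverse (fact N) * (2 * norm t) ^ N)" for N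
  proof -
    have "real (gen_coeff weak b (m + int N)) \<le> real (2 ^ (b + nat m) * 2 ^ N)"
      using gen_coeff_le by (simp only: of_nat_le_iff)
    then have "real (gen_coeff weak b (m + int N)) * (norm t ^ N / fact N)
        \<le> real (2 ^ (b + nat m) * 2 ^ N) * (norm t ^ N / fact N)"
      by (rule mult_right_mono) simp
    then show ?thesis
      by (simp add: norm_mult norm_divide norm_power power_mult_distrib field_simps)
  qed
qed

lemma symbol_coeff_sums:
  "(\<lambda>N. of_nat (gen_coeff weak b (m + int N)) / fact N * t ^ N) sums symbol_coeff weak b m t"
  unfolding symbol_coeff_def
  using summable_norm_cancel[OF summable_norm_symbol_coeff] by (rule summable_sums)

lemma symbol_coeff_at_0: "symbol_coeff weak b m 0 = of_nat (gen_coeff weak b m)"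
  using symbol_coeff_sums[of weak b m 0] unfolding powser_sums_zero_iff by simp

lemma symbol_coeff_step:
  assumes "0 < x"
  shows "symbol_coeff weak x (m + 1) t =
         symbol_coeff weak (x - 1) (m + 1) t + symbol_coeff weak (x - of_bool weak) m t"
proof -
  have "gen_coeff weak x (m + 1 + int N) = gen_coeff weak (x - 1) (m + 1 + int N)
      + gen_coeff weak (x - of_bool weak) (m + int N)" for N
    using gen_coeff_step[OF assms, of weak "m + int N"] by (simp add: ac_simps)
  then have "(\<lambda>N. of_nat (gen_coeff weak x (m + 1 + int N)) / fact N * t ^ N) sums
      (symbol_coeff weak (x - 1) (m + 1) t + symbol_coeff weak (x - of_bool weak) m t)"
    using sums_add[OF symbol_coeff_sums[of weak "x - 1" "m + 1" t]
        symbol_coeff_sums[of weak "x - of_bool weak" m t]]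
    by (simp add: add_divide_distrib distrib_right)
  then show ?thesis
    using symbol_coeff_sums sums_unique2 by blast
qed

lemma symbol_coeff_telescope:
  assumes "a \<le> b"
  shows "symbol_coeff weak b (m + 1) t - symbol_coeff weak a (m + 1) t =
         (\<Sum>x\<in>{a<..b}. symbol_coeff weak (x - of_bool weak) m t)"
  using assms
proof (induction b rule: dec_induct)
  case (step b)
  have "{a<..Suc b} = insert (Suc b) {a<..b}" using step.hyps by auto
  then show ?case
    using step.IH symbol_coeff_step[of "Suc b" weak m t] by (simp add: algebra_simps)
qed simp

lemma symbol_coeff_0: "m > 0 \<Longrightarrow> symbol_coeff weak 0 m t = 0"
  by (simp add: symbol_coeff_def gen_coeff_0)

lemma symbol_coeff_deriv:
  "(symbol_coeff weak b m has_field_derivative symbol_coeff weak b (m + 1) t) (at t)"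
proof -
  have "diffs (\<lambda>N. of_nat (gen_coeff weak b (m + int N)) / fact N :: complex) =
      (\<lambda>N. of_nat (gen_coeff weak b (m + 1 + int N)) / fact N)"
  proof
    fix N
    have "m + int (Suc N) = m + 1 + int N" by simp
    then show "diffs (\<lambda>N. of_nat (gen_coeff weak b (m + int N)) / fact N :: complex) N =
        of_nat (gen_coeff weak b (m + 1 + int N)) / fact N"
      unfolding diffs_def \<open>m + int (Suc N) = m + 1 + int N\<close> by (simp del: of_nat_Suc)
  qed
  then show ?thesis
    using termdiffs_strong_converges_everywhere[of
        "\<lambda>N. of_nat (gen_coeff weak b (m + int N)) / fact N" t,
        OF summable_norm_cancel[OF summable_norm_symbol_coeff]]
    by (simp add: symbol_coeff_def[abs_def])
qed

text \<open>The thresholds are numbered from \<open>1\<close> and the columns from \<open>0\<close>, whence the \<open>Suc\<close>.\<close>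

definition threshold_det :: "bool \<Rightarrow> nat \<Rightarrow> (nat \<Rightarrow> nat) \<Rightarrow> complex \<Rightarrow> complex" where
  "threshold_det weak n b t =
     column_det n (\<lambda>j i. symbol_coeff weak (b (Suc j)) (int i - int j) t)"

lemma threshold_det_at_0: "threshold_det weak n b 0 = 1"
proof -
  let ?A = "mat n n (\<lambda>(i, j). symbol_coeff weak (b (Suc j)) (int i - int j) 0)"
  have "Determinant.det ?A = prod_list (diag_mat ?A)"
    by (rule det_lower_triangular[of n]) (auto simp: symbol_coeff_at_0 gen_coeff_def)
  also have "\<dots> = 1"
    by (auto simp: prod_list_diag_prod symbol_coeff_at_0 gen_coeff_constant intro!: prod.neutral)
  finally show ?thesis by (simp add: threshold_det_def column_det_def)
qed

text \<open>The determinants obey the same linear system as the generating functions of the path counts.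
  The derivative of column \<open>j\<close> telescopes into one summand per letter that changes the threshold
  \<open>b (Suc j)\<close>, up to a boundary column that makes the determinant vanish.\<close>

lemma threshold_det_deriv:
  assumes b: "threshold_vector k n b"
  shows "(threshold_det weak n b has_field_derivative
      (\<Sum>j<n. \<Sum>x\<in>{b j<..b (Suc j)}. threshold_det weak n (b(Suc j := x - of_bool weak)) t)) (at t)"
proof -
  define C where "C j i = symbol_coeff weak (b (Suc j)) (int i - int j) t" for j i
  have "(threshold_det weak n b has_field_derivative
      (\<Sum>j<n. column_det n (C(j := \<lambda>i. symbol_coeff weak (b (Suc j)) (int i - int j + 1) t)))) (at t)"
    unfolding threshold_det_def[abs_def] C_def
    by (rule has_field_derivative_column_det) (rule symbol_coeff_deriv)
  also have "(\<Sum>j<n. column_det n (C(j := \<lambda>i. symbol_coeff weak (b (Suc j)) (int i - int j + 1) t))) =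
      (\<Sum>j<n. \<Sum>x\<in>{b j<..b (Suc j)}. threshold_det weak n (b(Suc j := x - of_bool weak)) t)"
  proof (intro sum.cong refl)
    fix j assume "j \<in> {..<n}"
    then have j: "j < n" by simp
    let ?u = "\<lambda>i. symbol_coeff weak (b (Suc j)) (int i - int j + 1) t"
    let ?v = "\<lambda>i. symbol_coeff weak (b j) (int i - int j + 1) t"
    \<comment> \<open>the boundary column vanishes for \<open>j = 0\<close> and repeats the preceding column otherwise\<close>
    have "column_det n (C(j := ?v)) = 0"
    proof (cases j)
      case 0
      then have "?v i = 0" for i
        using b symbol_coeff_0[of "int i + 1" weak t] by (simp add: threshold_vector_def)
      then show ?thesis
        using j by (intro column_det_zero_column[of j]) auto
    next
      case (Suc l)
      then show ?thesis
        using j by (intro column_det_equal_columns[of j n l]) (auto simp: C_def)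
    qed
    then have "column_det n (C(j := ?u)) = column_det n (C(j := \<lambda>i. ?u i - ?v i))"
      using j by (simp add: column_det_update_diff)
    also have "(\<lambda>i. ?u i - ?v i) =
        (\<lambda>i. \<Sum>x\<in>{b j<..b (Suc j)}. symbol_coeff weak (x - of_bool weak) (int i - int j) t)"
      using b j by (intro ext symbol_coeff_telescope) (auto simp: threshold_vector_def)
    also have "column_det n (C(j := \<dots>)) = (\<Sum>x\<in>{b j<..b (Suc j)}.
        column_det n (C(j := \<lambda>i. symbol_coeff weak (x - of_bool weak) (int i - int j) t)))"
      using j by (rule column_det_update_sum)
    also have "\<dots> = (\<Sum>x\<in>{b j<..b (Suc j)}. threshold_det weak n (b(Suc j := x - of_bool weak)) t)"
      unfolding threshold_det_def C_def by (intro sum.cong refl column_det_cong) auto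
    finally show "column_det n (C(j := ?u)) =
        (\<Sum>x\<in>{b j<..b (Suc j)}. threshold_det weak n (b(Suc j := x - of_bool weak)) t)" .
  qed
  finally show ?thesis .
qed

lemma threshold_det_holomorphic:
  assumes "threshold_vector k n b"
  shows "threshold_det weak n b holomorphic_on UNIV"
  unfolding holomorphic_on_def field_differentiable_def
  using threshold_det_deriv[OF assms] by (blast intro: has_field_derivative_at_within)

lemma higher_deriv_sum:
  assumes "\<And>i. i \<in> I \<Longrightarrow> f i holomorphic_on UNIV"
  shows "(deriv ^^ N) (\<lambda>z. \<Sum>i\<in>I. f i z) z = (\<Sum>i\<in>I. (deriv ^^ N) (f i) z)"
  using assms
proof (induction I rule: infinite_finite_induct)
  case (insert i I)
  then show ?case
    by (simp add: higher_deriv_add[of _ UNIV] holomorphic_on_sum)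
qed simp_all

text \<open>Each differentiation of the determinant corresponds to reading one letter.\<close>

lemma higher_deriv_threshold_det:
  assumes "threshold_vector k n b"
  shows "(deriv ^^ N) (threshold_det weak n b) 0 = of_nat (card (admissible_words weak k n N b))"
  using assms
proof (induction N arbitrary: b)
  case 0
  then show ?case by (simp add: threshold_det_at_0 card_admissible_words_0)
next
  case (Suc N)
  let ?b = "\<lambda>j x. b(Suc j := x - of_bool weak)"
  have step: "threshold_vector k n (?b j x)" if "j < n" "x \<in> {b j<..b (Suc j)}" for j x
    using threshold_vector_update[OF Suc.prems] that by simp
  have "deriv (threshold_det weak n b) =
      (\<lambda>t. \<Sum>j<n. \<Sum>x\<in>{b j<..b (Suc j)}. threshold_det weak n (?b j x) t)"
    using threshold_det_deriv[OF Suc.prems] DERIV_imp_deriv by blast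
  then have "(deriv ^^ Suc N) (threshold_det weak n b) 0 =
      (deriv ^^ N) (\<lambda>t. \<Sum>j<n. \<Sum>x\<in>{b j<..b (Suc j)}. threshold_det weak n (?b j x) t) 0"
    by (simp add: funpow_Suc_right del: funpow.simps)
  also have "\<dots> = (\<Sum>j<n. \<Sum>x\<in>{b j<..b (Suc j)}. (deriv ^^ N) (threshold_det weak n (?b j x)) 0)"
    using threshold_det_holomorphic[OF step]
    by (subst higher_deriv_sum) (auto intro!: holomorphic_on_sum sum.cong higher_deriv_sum)
  also have "\<dots> = (\<Sum>j<n. \<Sum>x\<in>{b j<..b (Suc j)}. of_nat (card (admissible_words weak k n N (?b j x))))"
    by (intro sum.cong refl Suc.IH step) auto
  also have "\<dots> = of_nat (card (admissible_words weak k n (Suc N) b))"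
    by (simp add: card_admissible_words_Suc[OF Suc.prems])
  finally show ?case .
qed

lemma threshold_det_sums:
  assumes "threshold_vector k n b"
  shows "(\<lambda>N. of_nat (card (admissible_words weak k n N b)) / fact N * t ^ N) sums
           threshold_det weak n b t"
  using holomorphic_power_series[of "threshold_det weak n b" 0 "norm t + 1" t]
    holomorphic_on_subset[OF threshold_det_holomorphic[OF assms]]
  by (simp add: higher_deriv_threshold_det[OF assms])

section \<open>Laurent coefficients of the symbols\<close>

text \<open>The part with negative exponents is a power series \<open>Q\<close> in \<open>1 / z\<close> that converges for arbitrarily
  large arguments, so \<open>Q\<close> is entire; the part with nonnegative exponents is a power series \<open>P\<close> in
  the unit disc. As \<open>Q w = - P (1 / w)\<close> tends to \<open>- P 0\<close> at infinity, Liouville's theorem makes \<open>Q\<close>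
  constant. Both series therefore vanish identically.\<close>

lemma laurent_series_eq_0:
  fixes a :: "int \<Rightarrow> complex"
  assumes sum0: "\<And>z. 0 < norm z \<Longrightarrow> norm z < 1 \<Longrightarrow> ((\<lambda>i. a i * z powi i) has_sum 0) UNIV"
  shows "a i = 0"
proof -
  define p where "p n = a (int n)" for n
  \<comment> \<open>the constant term belongs to \<open>p\<close> alone, so \<open>Q 0 = 0\<close> identifies the constant \<open>Q\<close>\<close>
  define q where "q n = (if n = 0 then 0 else a (- int n))" for n
  define P where "P z = (\<Sum>n. p n * z ^ n)" for z
  define Q where "Q z = (\<Sum>n. q n * z ^ n)" for z
  have halves: "(\<lambda>n. p n * z ^ n) sums P z \<and> (\<lambda>n. q n * (1 / z) ^ n) sums Q (1 / z)
      \<and> P z + Q (1 / z) = 0" if z: "0 < norm z" "norm z < 1" for z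
  proof -
    let ?f = "\<lambda>i. a i * z powi i"
    have "?f summable_on UNIV" using sum0[OF z] by (rule has_sum_imp_summable)
    then obtain s1 s2 where s1: "(?f has_sum s1) {0..}" and s2: "(?f has_sum s2) {..<0}"
      by (metis has_sum_infsum summable_on_subset_banach subset_UNIV)
    have "(?f has_sum (s1 + s2)) ({0..} \<union> {..<0})"
      using s1 s2 by (rule has_sum_Un_disjoint) auto
    moreover have "{0..} \<union> {..<0} = (UNIV :: int set)" by auto
    ultimately have 0: "s1 + s2 = 0"
      using sum0[OF z] has_sum_unique by metis
    have "((\<lambda>n. p n * z ^ n) has_sum s1) UNIV \<longleftrightarrow> (?f has_sum s1) {0..}"
      by (rule has_sum_reindex_bij_witness[of _ nat int]) (auto simp: p_def)
    then have 1: "(\<lambda>n. p n * z ^ n) sums s1" using s1 has_sum_imp_sums by blast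
    have "((\<lambda>n. q n * (1 / z) ^ n) has_sum s2) {0<..} \<longleftrightarrow> (?f has_sum s2) {..<0}"
      by (rule has_sum_reindex_bij_witness[of _ "\<lambda>i. nat (- i)" "\<lambda>n. - int n"])
         (auto simp: q_def power_int_minus power_one_over field_simps)
    also have "((\<lambda>n. q n * (1 / z) ^ n) has_sum s2) {0<..} \<longleftrightarrow>
        ((\<lambda>n. q n * (1 / z) ^ n) has_sum s2) UNIV"
      by (rule has_sum_cong_neutral) (auto simp: q_def)
    finally have 2: "(\<lambda>n. q n * (1 / z) ^ n) sums s2" using s2 has_sum_imp_sums by blast
    from 0 1 2 show ?thesis by (simp add: P_def Q_def sums_iff)
  qed
  have P: "(\<lambda>n. p n * z ^ n) sums P z" if "norm z < 1" for z
  proof (cases "z = 0")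
    case True
    then show ?thesis by (simp add: P_def powser_zero)
  qed (use halves that in simp)
  have Qsum: "summable (\<lambda>n. q n * w ^ n)" for w
  proof (rule powser_inside)
    let ?x = "of_real (norm w + 2) :: complex"
    have n: "norm ?x = norm w + 2" by (metis abs_norm_cancel norm_of_real abs_of_nonneg add_nonneg_nonneg norm_ge_zero zero_le_numeral)
    moreover have "1 < norm w + 2" using norm_ge_zero[of w] by linarith
    ultimately have "0 < norm (1 / ?x)" "norm (1 / ?x) < 1"
      by (auto simp: norm_divide simp del: of_real_add)
    from halves[OF this] show "summable (\<lambda>n. q n * ?x ^ n)"
      by (auto simp: sums_iff simp del: of_real_add)
    show "norm w < norm ?x" using n by linarith
  qed
  then have Q: "(\<lambda>n. q n * w ^ n) sums Q w" for w
    unfolding Q_def by (rule summable_sums)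
  have "Q holomorphic_on UNIV"
    unfolding holomorphic_on_def field_differentiable_def Q_def[abs_def]
    using termdiffs_strong_converges_everywhere[OF Qsum] by (blast intro: has_field_derivative_at_within)
  moreover have "(Q \<longlongrightarrow> - p 0) at_infinity"
  proof -
    have "isCont P 0"
      unfolding P_def[abs_def] using P[of "1/2"]
      by (intro isCont_powser[where K = "1/2"]) (auto simp: sums_iff)
    moreover have "P 0 = p 0" by (simp add: P_def powser_zero)
    ultimately have "(P \<longlongrightarrow> p 0) (at 0)" by (simp add: isCont_def)
    moreover have "filterlim (\<lambda>w. 1 / w :: complex) (at 0) at_infinity"
      unfolding filterlim_def at_to_infinity by (simp add: inverse_eq_divide[abs_def])
    ultimately have "((\<lambda>w. P (1 / w)) \<longlongrightarrow> p 0) at_infinity"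
      by (rule filterlim_compose)
    then have "((\<lambda>w. - P (1 / w)) \<longlongrightarrow> - p 0) at_infinity"
      by (rule tendsto_minus)
    moreover have "\<forall>\<^sub>F w in at_infinity. - P (1 / w) = Q w"
    proof (rule eventually_at_infinityI[of 2])
      fix w :: complex assume "2 \<le> norm w"
      then have "0 < norm (1 / w)" "norm (1 / w) < 1"
        by (auto simp: norm_divide divide_simps)
      from halves[OF this] show "- P (1 / w) = Q w"
        by (simp add: add_eq_0_iff)
    qed
    ultimately show ?thesis by (rule Lim_transform_eventually)
  qed
  ultimately have Q_const: "Q w = - p 0" for w by (rule Liouville_weak)
  moreover have q0: "q 0 = 0" by (simp add: q_def)
  moreover have "Q 0 = q 0" by (simp add: Q_def powser_zero)
  ultimately have p0: "p 0 = 0" and Q0: "Q w = 0" for w by auto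
  have q: "q n = 0" for n
  proof (rule ccontr)
    assume "q n \<noteq> 0"
    with q0 have "n > 0" by (metis gr0I)
    with \<open>q n \<noteq> 0\<close> obtain s where "0 < s" "\<And>z. z \<in> cball 0 s - {0} \<Longrightarrow> Q z \<noteq> 0"
      using powser_0_nonzero[of 1 0 q Q n] Q Q0 by auto
    from this(2)[of "of_real s"] \<open>0 < s\<close> Q0 show False by simp
  qed
  have P0: "P z = 0" if "norm z < 1" for z
  proof (cases "z = 0")
    case True
    then show ?thesis using p0 by (simp add: P_def powser_zero)
  qed (use halves[of z] that Q0 in simp)
  have p: "p n = 0" for n
  proof (rule ccontr)
    assume "p n \<noteq> 0"
    with p0 have "n > 0" by (metis gr0I)
    with \<open>p n \<noteq> 0\<close> obtain s where s: "0 < s" "\<And>z. z \<in> cball 0 s - {0} \<Longrightarrow> P z \<noteq> 0"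
      using powser_0_nonzero[of 1 0 p P n] P P0 by auto
    have "P (of_real (min s (1/2))) \<noteq> 0"
      using s by (intro s(2)) auto
    then show False using P0[of "of_real (min s (1/2))"] \<open>0 < s\<close> by simp
  qed
  show ?thesis
    using p[of "nat i"] q[of "nat (- i)"] by (cases "i \<ge> 0") (auto simp: p_def q_def)
qed

lemma laurent_coeff_eqI:
  assumes exp: "is_laurent_expansion A f a" and A: "ball 0 1 - {0} \<subseteq> A"
  shows "laurent_coeff A f = a"
  unfolding laurent_coeff_def
proof (rule the_equality)
  show "is_laurent_expansion A f a" by (rule exp)
  fix a' assume exp': "is_laurent_expansion A f a'"
  have "((\<lambda>i. (a' i - a i) * z powi i) has_sum 0) UNIV" if "0 < norm z" "norm z < 1" for z
  proof -
    have "z \<in> A" using that A by auto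
    then have "((\<lambda>i. a' i * z powi i) has_sum f z) UNIV" "((\<lambda>i. a i * z powi i) has_sum f z) UNIV"
      using exp exp' unfolding is_laurent_expansion_def by auto
    then have "((\<lambda>i. a' i * z powi i + - (a i * z powi i)) has_sum (f z + - f z)) UNIV"
      by (intro has_sum_add) (simp_all add: has_sum_uminus)
    then show ?thesis by (simp add: algebra_simps)
  qed
  then have "a' i - a i = 0" for i by (rule laurent_series_eq_0)
  then show "a' = a" by (simp add: fun_eq_iff)
qed

text \<open>The double series of the product of \<open>exp (t / z)\<close> with the generating function converges
  absolutely, so its terms may be collected according to the exponent \<open>i = m - N\<close> of \<open>z\<close>.\<close>

lemma symbol_coeff_has_sum:
  assumes z: "z \<noteq> 0"
    and g: "((\<lambda>m. of_nat (gen_coeff weak k (int m)) * z ^ m) has_sum g) UNIV"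
  shows "((\<lambda>i. symbol_coeff weak k i t * z powi i) has_sum (exp (t / z) * g)) UNIV"
proof -
  define e where "e N = (t / z) ^ N / fact N" for N
  define c where "c m = of_nat (gen_coeff weak k (int m)) * z ^ m" for m
  define F where "F = (\<lambda>(i, N). of_nat (gen_coeff weak k (i + int N)) / fact N * t ^ N * z powi i)"
  have "summable (\<lambda>N. norm (e N))"
    using summable_norm_exp[of "t / z"] by (simp add: e_def scaleR_conv_of_real field_simps norm_mult norm_divide norm_power)
  moreover have "e sums exp (t / z)"
    using exp_converges[of "t / z"] unfolding e_def[abs_def] by (simp add: scaleR_conv_of_real field_simps)
  ultimately have e: "(e has_sum exp (t / z)) UNIV"
    by (rule norm_summable_imp_has_sum)
  have "((\<lambda>(N, m). e N * c m) has_sum (exp (t / z) * g)) (UNIV \<times> UNIV)"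
  proof (rule has_sum_SigmaI)
    show "((\<lambda>m. case (N, m) of (N, m) \<Rightarrow> e N * c m) has_sum (e N * g)) UNIV" for N
      using has_sum_cmult_right[OF g] by (simp add: c_def)
    show "((\<lambda>N. e N * g) has_sum (exp (t / z) * g)) UNIV"
      using e by (rule has_sum_cmult_left)
    have abs: "(\<lambda>N. norm (e N)) summable_on UNIV" "(\<lambda>m. norm (c m)) summable_on UNIV"
      using has_sum_imp_summable[OF e] has_sum_imp_summable[OF g]
      unfolding c_def summable_on_iff_abs_summable_on_complex by blast+
    show "(\<lambda>(N, m). e N * c m) summable_on UNIV \<times> UNIV"
    proof (rule abs_summable_summable)
      show "(\<lambda>p. norm (case p of (N, m) \<Rightarrow> e N * c m)) summable_on UNIV \<times> UNIV"
      proof (rule Infinite_Sum.abs_summable_on_Sigma_iff[THEN iffD2], intro conjI ballI)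
        show "(\<lambda>m. norm (case (N, m) of (N, m) \<Rightarrow> e N * c m)) summable_on UNIV" for N
          using abs(2) by (simp add: norm_mult summable_on_cmult_right)
        have "(\<lambda>N. norm (e N) * (\<Sum>\<^sub>\<infinity>m. norm (c m))) summable_on UNIV"
          using abs(1) by (rule summable_on_cmult_left)
        moreover have "0 \<le> (\<Sum>\<^sub>\<infinity>m. norm (c m))"
          by (rule infsum_nonneg) simp
        ultimately show "(\<lambda>N. norm (\<Sum>\<^sub>\<infinity>m. norm (case (N, m) of (N, m) \<Rightarrow> e N * c m))) summable_on UNIV"
          using abs(2) by (simp add: norm_mult infsum_cmult_right abs_mult)
      qed
    qed
  qed
  also have "?this \<longleftrightarrow> (F has_sum (exp (t / z) * g)) {(i, N). 0 \<le> i + int N}"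
  proof (rule has_sum_reindex_bij_witness[of _ "\<lambda>(i, N). (N, nat (i + int N))"
        "\<lambda>(N, m). (int m - int N, N)"])
    show "F (case a of (N, m) \<Rightarrow> (int m - int N, N)) = (case a of (N, m) \<Rightarrow> e N * c m)" for a
      using z by (auto simp: F_def e_def c_def power_int_diff field_simps split: prod.splits)
  qed auto
  \<comment> \<open>\<open>gen_coeff\<close> vanishes at negative arguments, so the pairs with \<open>i + N < 0\<close> may be added\<close>
  also have "\<dots> \<longleftrightarrow> (F has_sum (exp (t / z) * g)) (UNIV \<times> UNIV)"
    by (rule has_sum_cong_neutral) (auto simp: F_def gen_coeff_def)
  finally show ?thesis
  proof (rule has_sum_SigmaD)
    fix i
    show "((\<lambda>N. F (i, N)) has_sum (symbol_coeff weak k i t * z powi i)) UNIV"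
      using has_sum_cmult_left[OF norm_summable_imp_has_sum[OF
          summable_norm_symbol_coeff symbol_coeff_sums]]
      by (simp add: F_def)
  qed
qed

lemma gen_coeff_weak_has_sum:
  "((\<lambda>m. of_nat (gen_coeff True k (int m)) * z ^ m) has_sum (1 + z) ^ k) (UNIV :: nat set)"
  for z :: complex
proof -
  have "((\<lambda>m. of_nat (k choose m) * z ^ m) has_sum (\<Sum>m\<le>k. of_nat (k choose m) * z ^ m)) {..k}"
    by (rule has_sum_finite) simp
  also have "(\<Sum>m\<le>k. of_nat (k choose m) * z ^ m) = (1 + z) ^ k"
    using binomial_ring[of z 1 k] by (simp add: add.commute)
  also have "((\<lambda>m. of_nat (k choose m) * z ^ m) has_sum (1 + z) ^ k) {..k} \<longleftrightarrow> ?thesis"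
    by (rule has_sum_cong_neutral) (auto simp: gen_coeff_def)
  finally show ?thesis .
qed

lemma gen_coeff_strict_has_sum:
  fixes z :: complex
  assumes k: "k \<ge> 1" and z: "norm z < 1"
  shows "((\<lambda>m. of_nat (gen_coeff False k (int m)) * z ^ m) has_sum (1 - z) powi (- int k)) UNIV"
    (is "(?f has_sum _) UNIV")
proof (rule norm_summable_imp_has_sum)
  have sums: "(\<lambda>m. of_nat (gen_coeff False k (int m)) * z ^ m) sums ((1 - z) powi (- int k))"
    if "norm z < 1" for z :: complex
  proof -
    have "(- of_nat k gchoose m) * (- z) ^ m = of_nat (gen_coeff False k (int m)) * z ^ m" for m
    proof -
      have "of_nat k + of_nat m - 1 = (of_nat (k + m - 1) :: complex)"
        using k by (simp add: of_nat_diff)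
      then have "(- of_nat k gchoose m :: complex) = (- 1) ^ m * of_nat ((k + m - 1) choose m)"
        by (simp add: gbinomial_minus binomial_gbinomial)
      then show ?thesis
        by (simp add: gen_coeff_def power_minus[of z])
    qed
    moreover have "z \<noteq> 1" using that by auto
    then have "(1 - z) powr (- of_nat k) = (1 - z) powi (- int k)"
      using complex_powr_of_int[of "1 - z" "- int k"] by auto
    ultimately show ?thesis
      using gen_binomial_complex[of "- z" "- of_nat k"] that by simp
  qed
  show "?f sums (1 - z) powi (- int k)" using z by (rule sums)
  \<comment> \<open>a point of larger modulus inside the unit disc gives absolute convergence at \<open>z\<close>\<close>
  define y :: complex where "y = of_real ((1 + norm z) / 2)"
  have y: "norm y = (1 + norm z) / 2"
    unfolding y_def norm_of_real by (rule abs_of_nonneg) simp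
  have "summable (\<lambda>m. of_nat (gen_coeff False k (int m)) * y ^ m)"
    using z y by (intro sums_summable[OF sums]) simp
  then show "summable (\<lambda>m. norm (?f m))"
    by (rule powser_insidea) (use y z in simp)
qed

lemma toeplitz_det_eq_threshold_det:
  assumes "is_laurent_expansion A f (\<lambda>i. symbol_coeff weak k i t)" "ball 0 1 - {0} \<subseteq> A"
  shows "Determinant.det (toeplitz n A f) = threshold_det weak n (initial_thresholds k) t"
  unfolding toeplitz_def threshold_det_def column_det_def laurent_coeff_eqI[OF assms] by simp

section \<open>Toeplitz determinants as generating functions\<close>

lemma generating_function_eq_threshold_det:
  assumes k: "k \<ge> 1"
    and p: "\<And>N. p N = card (admissible_words weak k n N (initial_thresholds k)) / real k ^ N"
  shows "(\<Sum>N. of_real (p N) * (of_nat k * t) ^ N / fact N) =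
         threshold_det weak n (initial_thresholds k) t"
proof -
  have "threshold_vector k n (initial_thresholds k)"
    by (simp add: threshold_vector_def)
  note threshold_det_sums[OF this, of weak t]
  moreover have "of_real (p N) * (of_nat k * t) ^ N / fact N =
      of_nat (card (admissible_words weak k n N (initial_thresholds k))) / fact N * t ^ N" for N
    using k by (simp add: p power_mult_distrib)
  ultimately show ?thesis by (simp add: sums_iff)
qed

theorem theorem1:
  fixes k n :: nat and t :: complex
  assumes "k \<ge> 1" and "n \<ge> 1"
  shows "G_I n k (of_nat k * t) = Determinant.det (toeplitz n (- {0}) (f_I k t)) \<and>
         G_D n k (of_nat k * t) = Determinant.det (toeplitz n (ball 0 1 - {0}) (f_D k t))"
proof
  have "is_laurent_expansion (- {0}) (f_I k t) (\<lambda>i. symbol_coeff True k i t)"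
    unfolding is_laurent_expansion_def f_I_def
    using symbol_coeff_has_sum[OF _ gen_coeff_weak_has_sum] by auto
  then have "Determinant.det (toeplitz n (- {0}) (f_I k t)) =
      threshold_det True n (initial_thresholds k) t"
    by (rule toeplitz_det_eq_threshold_det) auto
  then show "G_I n k (of_nat k * t) = Determinant.det (toeplitz n (- {0}) (f_I k t))"
    unfolding G_I_def using generating_function_eq_threshold_det[OF assms(1) F_I_eq[OF assms(1)]] by simp
next
  have "is_laurent_expansion (ball 0 1 - {0}) (f_D k t) (\<lambda>i. symbol_coeff False k i t)"
    unfolding is_laurent_expansion_def f_D_def
    using symbol_coeff_has_sum[OF _ gen_coeff_strict_has_sum[OF assms(1)]] by auto
  then have "Determinant.det (toeplitz n (ball 0 1 - {0}) (f_D k t)) =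
      threshold_det False n (initial_thresholds k) t"
    by (rule toeplitz_det_eq_threshold_det) auto
  then show "G_D n k (of_nat k * t) = Determinant.det (toeplitz n (ball 0 1 - {0}) (f_D k t))"
    unfolding G_D_def using generating_function_eq_threshold_det[OF assms(1) F_D_eq[OF assms(1)]] by simp
qed

end
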